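(* Let $(a_k)_{k\ge1}$ be a sequence of positive real numbers with $\sum_{k=1}^\infty a_k=1$. For each $k\ge 1$ let $p_{0k},p_{1k}\ge0$ with $p_{0k}+p_{1k}=1$, and let $\varphi_1,\varphi_2,\dots$ be independent random variables such that $\varphi_k$ takes the value $0$ with probability $p_{0k}$ and the value $1$ with probability $p_{1k}$. Let $\varphi=\sum_{k=1}^\infty\varphi_k a_k$, $r_k=\sum_{i=k+1}^\infty a_i$ and $\delta_k=a_k/r_k$. Suppose that $\delta_k>1$ for all $k\in\mathbb{N}$. Then the distribution of $\varphi$ is of pure type, and: 1) it is purely discrete if and only if $$\prod_{k=1}^\infty\max\{p_{0k},p_{1k}\}>0;$$ 2) it is purely absolutely continuous if and only if both $$\sum_{k=1}^\infty(\delta_k-1)<\infty\qquad\text{and}\qquad\sum_{k=1}^\infty\left(\tfrac12-p_{0k}\right)^2<\infty;$$ 3) it is purely singular in all other cases.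
   Context: Pure type means that the distribution is either purely discrete (concentrated on an at most countable set), or purely absolutely continuous with respect to Lebesgue measure on $\mathbb{R}$, or purely singular (here: no atoms, and singular with respect to Lebesgue measure). *)

theory Defs
  imports "HOL-Probability.Probability"
begin

definition purely_discrete :: "real measure \<Rightarrow> bool" where
  "purely_discrete \<mu> \<longleftrightarrow> (\<exists>C. countable C \<and> emeasure \<mu> (- C) = 0)"

definition purely_abs_continuous :: "real measure \<Rightarrow> bool" where
  "purely_abs_continuous \<mu> \<longleftrightarrow> absolutely_continuous lborel \<mu>"

definition purely_singular :: "real measure \<Rightarrow> bool" where
  "purely_singular \<mu> \<longleftrightarrow>
     (\<forall>x. emeasure \<mu> {x} = 0) \<and> (\<exists>N \<in> null_sets lborel. emeasure \<mu> (- N) = 0)"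

(* These notions are meant for \<mu> with sets \<mu> = sets borel.  Then countable sets,
   elements of null_sets lborel and their complements are all measurable, so that a
   zero value of emeasure never comes from its convention on non-measurable sets. *)

definition pure_type :: "real measure \<Rightarrow> bool" where
  "pure_type \<mu> \<longleftrightarrow> purely_discrete \<mu> \<or> purely_abs_continuous \<mu> \<or> purely_singular \<mu>"

end

theory Submission
  imports Defs
begin

text \<open>The condition on \<open>\<delta>\<close> makes the closed intervals that contain the sums with a prescribed initial
  word of length n pairwise disjoint, so the law of the random sum is determined by the product
  weights of the words, and all \<open>2\<^sup>n\<close> intervals have the same length \<open>r\<close>, where \<open>2\<^sup>n r\<close> is the
  inverse of the product of the numbers \<open>1 + (\<delta>\<^sub>k - 1) / 2\<close> over the first n indices.

  An atom lies in at most one interval, so its mass is at most the product of the maxima; if that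
  product stays positive, Borel-Cantelli shows that almost surely only finitely many digits differ
  from the likelier one.  If \<open>2\<^sup>n r\<close> tends to 0, the law lives on a null set.  For the rest the
  law of the first n digits is compared with the uniform one, as in Kakutani's theorem: when
  the squared biases are not summable, the Hellinger affinity tends to 0, and collections of
  intervals of mass close to 1 and small length follow; when they are summable, the likelihood
  ratios are bounded in \<open>L\<^sup>2\<close>, and if moreover \<open>2\<^sup>n r\<close> is bounded below, Cauchy-Schwarz bounds
  the squared mass of every open set by a multiple of its Lebesgue measure.\<close>

section \<open>Null sets of full measure, and divergent series and products\<close>

lemma ex_null_set_of_full_measure:
  fixes \<mu> :: "real measure" and B :: "nat \<Rightarrow> real set"
  assumes "finite_measure \<mu>" and sets_eq: "sets \<mu> = sets borel"
    and B: "\<And>n. B n \<in> sets borel"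
    and small: "\<And>n. emeasure lborel (B n) \<le> ennreal (e n)"
    and large: "\<And>n. measure \<mu> (- B n) \<le> e n"
    and lim: "e \<longlonglongrightarrow> 0"
  shows "\<exists>N\<in>null_sets lborel. emeasure \<mu> (- N) = 0"
proof -
  interpret finite_measure \<mu> by fact
  have sp: "space \<mu> = UNIV"
    using sets_eq_imp_space_eq[OF sets_eq] by simp
  \<comment> \<open>On a subsequence where \<open>e\<close> is below a geometric sequence, lengths
    and missed masses are both summable. Borel-Cantelli then serves twice: Lebesgue-almost no point
    lies in infinitely many \<open>B (f j)\<close>, while \<mu>-almost every point lies in all but
    finitely many.\<close>
  have "\<exists>n. e n < (1/2) ^ j" for j :: nat
    using order_tendstoD(2)[OF lim, of "(1/2) ^ j"] by (auto simp: eventually_sequentially)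
  then obtain f where f: "\<And>j. e (f j) < (1/2) ^ j"
    by metis
  define N where "N = limsup (\<lambda>j. B (f j))"
  have geo: "summable (\<lambda>j. (1/2::real) ^ j)"
    by (rule summable_geometric) simp
  have e_nonneg: "0 \<le> e n" for n
    using large[of n] measure_nonneg[of \<mu> "- B n"] by linarith
  have fin: "emeasure lborel (B n) < \<infinity>" for n
    using small[of n] by (metis ennreal_less_top infinity_ennreal_def order_le_less_trans)
  have "measure lborel (B (f j)) \<le> (1/2) ^ j" for j
  proof -
    have "measure lborel (B (f j)) \<le> e (f j)"
      unfolding measure_def using small[of "f j"] e_nonneg[of "f j"] by (simp add: enn2real_leI)
    then show ?thesis using f[of j] by linarith
  qed
  then have "summable (\<lambda>j. measure lborel (B (f j)))"
    by (intro summable_comparison_test'[OF geo, of 0]) auto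
  then have null: "N \<in> null_sets lborel"
    unfolding N_def using B fin by (intro borel_cantelli_limsup1) auto
  have "measure \<mu> (- B (f j)) \<le> (1/2) ^ j" for j
    using large[of "f j"] f[of j] by linarith
  then have "summable (\<lambda>j. measure \<mu> (- B (f j)))"
    by (intro summable_comparison_test'[OF geo, of 0]) auto
  then have "AE x in \<mu>. eventually (\<lambda>j. x \<in> space \<mu> - - B (f j)) sequentially"
    using B by (intro borel_cantelli_AE1) (auto simp: sets_eq less_top[symmetric])
  then have "AE x in \<mu>. x \<in> N"
  proof (rule AE_mp, intro AE_I2 impI)
    fix x assume "eventually (\<lambda>j. x \<in> space \<mu> - - B (f j)) sequentially"
    then obtain m where m: "\<And>j. m \<le> j \<Longrightarrow> x \<in> B (f j)"
      by (auto simp: eventually_sequentially)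
    show "x \<in> N"
      unfolding N_def limsup_INF_SUP
    proof (intro INT_I UN_I)
      show "max m n \<in> {n..}" for n by simp
      show "x \<in> B (f (max m n))" for n by (rule m) simp
    qed
  qed
  moreover have "N \<in> sets borel" using null by auto
  ultimately have "emeasure \<mu> (- N) = 0"
    by (subst (asm) AE_iff_measurable[where N="- N"]) (auto simp: sets_eq sp)
  then show ?thesis using null by blast
qed

lemma filterlim_partial_sums_at_top:
  fixes f :: "nat \<Rightarrow> real"
  assumes nonneg: "\<And>k. 0 \<le> f k" and "\<not> summable f"
  shows "filterlim (\<lambda>n. \<Sum>k<n. f k) at_top sequentially"
proof (unfold filterlim_at_top, intro allI)
  fix Z
  have "\<exists>n. Z < (\<Sum>k<n. f k)"
    using summableI_nonneg_bounded[of f Z] assms by (meson not_le)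
  then obtain m where m: "Z < (\<Sum>k<m. f k)" by blast
  have "Z \<le> (\<Sum>k<n. f k)" if "m \<le> n" for n
  proof -
    have "(\<Sum>k<m. f k) \<le> (\<Sum>k<n. f k)"
      using that nonneg by (intro sum_mono2) auto
    with m show ?thesis by linarith
  qed
  then show "eventually (\<lambda>n. Z \<le> (\<Sum>k<n. f k)) sequentially"
    by (auto simp: eventually_sequentially)
qed

text \<open>Transfers divergence from a series to the product; the inductive step only needs that
  the earlier factors multiply to at least 1.\<close>

lemma sum_le_prod_one_plus:
  fixes x :: "nat \<Rightarrow> real"
  assumes "\<And>k. 0 \<le> x k"
  shows "(\<Sum>k<n. x k) \<le> (\<Prod>k<n. 1 + x k)"
proof (induction n)
  case (Suc n)
  have "1 \<le> (\<Prod>k<n. 1 + x k)"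
    using assms by (intro prod_ge_1) simp
  then have "x n * 1 \<le> x n * (\<Prod>k<n. 1 + x k)"
    using assms by (intro mult_left_mono)
  then show ?case using Suc by (simp add: algebra_simps)
qed simp

section \<open>Geometry of the cylinder intervals\<close>

locale superdecreasing_series =
  fixes a :: "nat \<Rightarrow> real"
  assumes summable_a: "summable a"
    and tail_less: "\<And>n. (\<Sum>i. a (i + Suc n)) < a n"
    and a_pos: "\<And>n. 0 < a n"
begin

text \<open>The remainder r at index n is \<open>tail (Suc n)\<close>, since \<open>tail n\<close>
  still includes \<open>a n\<close>; so \<delta> is \<open>a n / tail (Suc n)\<close>.\<close>

definition tail :: "nat \<Rightarrow> real" where
  "tail n = (\<Sum>i. a (i + n))"

text \<open>A 0-1 word of length n is encoded by the set \<open>S \<subseteq> {..<n}\<close> of the positions of its ones.\<close>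

definition cyl :: "nat \<Rightarrow> nat set \<Rightarrow> real set" where
  "cyl n S = {sum a S .. sum a S + tail n}"

definition cyls :: "nat \<Rightarrow> nat set set \<Rightarrow> real set" where
  "cyls n A = (\<Union>S\<in>A. cyl n S)"

lemma tail_Suc: "tail n = a n + tail (Suc n)"
proof -
  have "summable (\<lambda>i. a (i + n))"
    using summable_a summable_iff_shift by blast
  from suminf_split_head[OF this] show ?thesis
    by (simp add: tail_def)
qed

lemma tail_pos: "0 < tail n"
  unfolding tail_def using summable_a summable_iff_shift a_pos by (intro suminf_pos) blast+

lemma tail_Suc_less: "tail (Suc n) < a n"
  using tail_less by (simp add: tail_def)

lemma sum_add_tail: "m \<le> n \<Longrightarrow> sum a {m..<n} + tail n = tail m"
proof (induction n rule: dec_induct)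
  case (step n)
  then show ?case using tail_Suc[of n] by simp
qed simp

lemma tail_tendsto_0: "tail \<longlonglongrightarrow> 0"
  unfolding tail_def by (rule suminf_exist_split2[OF summable_a])

text \<open>Words are ordered lexicographically: at the first difference \<open>T\<close> gains
  \<open>a k\<close>, which exceeds \<open>tail (Suc k)\<close>, the most that \<open>S\<close> can
  still collect.\<close>

lemma sum_add_tail_less:
  assumes S: "S \<subseteq> {..<n}" and T: "T \<subseteq> {..<n}" and k: "k \<in> T" "k \<notin> S"
    and below: "\<And>i. i < k \<Longrightarrow> i \<in> S \<longleftrightarrow> i \<in> T"
  shows "sum a S + tail n < sum a T"
proof -
  let ?L = "S \<inter> {..<k}"
  have fin: "finite S" "finite T" using S T finite_subset by blast+
  have kn: "k < n" using k T by auto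
  \<comment> \<open>Worst case: every digit of \<open>S\<close> after position \<open>k\<close> is
    one.\<close>
  have "sum a S \<le> sum a (?L \<union> {Suc k..<n})"
  proof (rule sum_mono2)
    show "S \<subseteq> ?L \<union> {Suc k..<n}"
    proof
      fix i assume "i \<in> S"
      then have "i \<noteq> k" "i < n" using S k by auto
      then show "i \<in> ?L \<union> {Suc k..<n}" using \<open>i \<in> S\<close> by auto
    qed
  qed (auto intro: less_imp_le a_pos)
  also have "\<dots> = sum a ?L + sum a {Suc k..<n}"
    by (rule sum.union_disjoint) auto
  finally have "sum a S + tail n \<le> sum a ?L + tail (Suc k)"
    using sum_add_tail[of "Suc k" n] kn by simp
  also have "\<dots> < sum a ?L + a k"
    using tail_Suc_less by simp
  also have "\<dots> = sum a (insert k ?L)"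
    by simp
  also have "\<dots> \<le> sum a T"
    using below k fin by (intro sum_mono2) (auto intro: less_imp_le a_pos)
  finally show ?thesis .
qed

lemma cyl_disjoint:
  assumes S: "S \<subseteq> {..<n}" and T: "T \<subseteq> {..<n}" and "S \<noteq> T"
  shows "cyl n S \<inter> cyl n T = {}"
proof -
  \<comment> \<open>The first position where the words differ; the word with digit one there lies
    strictly to the right.\<close>
  define k where "k = (LEAST i. i \<in> S \<longleftrightarrow> i \<notin> T)"
  have ex: "\<exists>i. i \<in> S \<longleftrightarrow> i \<notin> T" using \<open>S \<noteq> T\<close> by blast
  have k: "k \<in> S \<longleftrightarrow> k \<notin> T"
    unfolding k_def using ex by (rule LeastI_ex)
  have below: "i \<in> S \<longleftrightarrow> i \<in> T" if "i < k" for i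
    using not_less_Least[OF that[unfolded k_def]] by blast
  show ?thesis
  proof (cases "k \<in> T")
    case True
    then show ?thesis
      using sum_add_tail_less[OF S T, of k] k below by (auto simp: cyl_def)
  next
    case False
    then show ?thesis
      using sum_add_tail_less[OF T S, of k] k below by (auto simp: cyl_def)
  qed
qed

text \<open>The first n digits give the left endpoint exactly, the others add between 0 and
  \<open>tail n\<close>.\<close>

lemma expansion_mem_cyl:
  assumes d: "\<And>k. d k \<in> {0, 1::real}"
  shows "(\<Sum>k. d k * a k) \<in> cyl n {k \<in> {..<n}. d k = 1}"
proof -
  have d01: "0 \<le> d k" "d k \<le> 1" for k using d[of k] by auto
  have le: "d k * a k \<le> a k" "0 \<le> d k * a k" for k
    using mult_right_mono[OF d01(2)[of k], of "a k"] d01(1)[of k] a_pos[of k]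
    by (auto simp: less_imp_le)
  have summ: "summable (\<lambda>k. d k * a k)"
    using le by (intro summable_comparison_test'[OF summable_a, of 0]) auto
  then have "summable (\<lambda>k. d (k + n) * a (k + n))" "summable (\<lambda>k. a (k + n))"
    using summable_a summable_iff_shift[of "\<lambda>k. d k * a k" n] summable_iff_shift[of a n] by auto
  then have "(\<Sum>k. d (k + n) * a (k + n)) \<le> tail n" "0 \<le> (\<Sum>k. d (k + n) * a (k + n))"
    unfolding tail_def using le by (auto intro: suminf_le suminf_nonneg)
  moreover have "(\<Sum>k<n. d k * a k) = sum a {k \<in> {..<n}. d k = 1}"
  proof -
    have "(\<Sum>k<n. d k * a k) = (\<Sum>k<n. if d k = 1 then a k else 0)"
    proof (rule sum.cong)
      fix k show "d k * a k = (if d k = 1 then a k else 0)" using d[of k] by auto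
    qed simp
    also have "\<dots> = sum a {k \<in> {..<n}. d k = 1}"
      by (rule sum.inter_filter[symmetric]) simp
    finally show ?thesis .
  qed
  ultimately show ?thesis
    unfolding cyl_def suminf_split_initial_segment[OF summ, of n] by simp
qed

text \<open>Disjointness lets the digits be read off from the sum: it lies in the interval of its
  own word, hence in no other.\<close>

lemma expansion_mem_cyl_iff:
  assumes d: "\<And>k. d k \<in> {0, 1::real}" and S: "S \<subseteq> {..<n}"
  shows "(\<Sum>k. d k * a k) \<in> cyl n S \<longleftrightarrow> (\<forall>k<n. d k = (if k \<in> S then 1 else 0))"
proof -
  have "(\<Sum>k. d k * a k) \<in> cyl n S \<longleftrightarrow> {k \<in> {..<n}. d k = 1} = S"
    using expansion_mem_cyl[of d n, OF d] cyl_disjoint[of "{k \<in> {..<n}. d k = 1}" n S] S by auto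
  also have "\<dots> \<longleftrightarrow> (\<forall>k<n. d k = 1 \<longleftrightarrow> k \<in> S)"
    using S by auto
  also have "\<dots> \<longleftrightarrow> (\<forall>k<n. d k = (if k \<in> S then 1 else 0))"
    using d by (metis insert_iff empty_iff zero_neq_one)
  finally show ?thesis .
qed

lemma disjoint_family_cyl:
  assumes "A \<subseteq> Pow {..<n}"
  shows "disjoint_family_on (cyl n) A"
proof (unfold disjoint_family_on_def, intro ballI impI)
  fix S T assume "S \<in> A" "T \<in> A" "S \<noteq> T"
  with assms show "cyl n S \<inter> cyl n T = {}" by (intro cyl_disjoint) auto
qed

lemma finite_words: "A \<subseteq> Pow {..<n::nat} \<Longrightarrow> finite A"
  using finite_subset by blast

lemma cyl_borel [measurable]: "cyl n S \<in> sets borel"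
  by (simp add: cyl_def)

lemma cyls_borel: "A \<subseteq> Pow {..<n} \<Longrightarrow> cyls n A \<in> sets borel"
  unfolding cyls_def by (intro sets.finite_UN finite_words) auto

lemma emeasure_lborel_cyls:
  assumes "A \<subseteq> Pow {..<n}"
  shows "emeasure lborel (cyls n A) = ennreal (card A * tail n)"
proof -
  have "emeasure lborel (cyls n A) = (\<Sum>S\<in>A. emeasure lborel (cyl n S))"
    unfolding cyls_def using assms
    by (intro sum_emeasure[symmetric] disjoint_family_cyl finite_words) auto
  also have "\<dots> = (\<Sum>S\<in>A. ennreal (tail n))"
    using tail_pos[of n] by (simp add: cyl_def less_imp_le)
  also have "\<dots> = ennreal (card A * tail n)"
    using tail_pos[of n] by (simp add: ennreal_mult less_imp_le ennreal_of_nat_eq_real_of_nat)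
  finally show ?thesis .
qed

section \<open>Total length of the intervals of level n\<close>

lemma two_power_tail_eq:
  "2 ^ n * tail n * (\<Prod>k<n. 1 + (a k / tail (Suc k) - 1) / 2) = tail 0"
proof (induction n)
  case (Suc n)
  \<comment> \<open>With \<delta> for the ratio, \<open>tail n\<close> is 1 + \<delta> times
    \<open>tail (Suc n)\<close>, and 1 + \<delta> = 2 (1 + (\<delta> - 1) / 2).\<close>
  have "2 * tail (Suc n) * (1 + (a n / tail (Suc n) - 1) / 2) = tail n"
    using tail_pos[of "Suc n"] tail_Suc[of n] by (simp add: field_simps)
  with Suc have "2 ^ n * (2 * tail (Suc n) * (1 + (a n / tail (Suc n) - 1) / 2))
        * (\<Prod>k<n. 1 + (a k / tail (Suc k) - 1) / 2) = tail 0"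
    by (simp only:)
  then show ?case
    by (simp only: power_Suc prod.lessThan_Suc mult.assoc mult.commute mult.left_commute)
qed simp

lemma ratio_gt_1: "1 < a n / tail (Suc n)"
  using tail_pos[of "Suc n"] tail_Suc_less[of n] by simp

lemma two_power_tail_le: "2 ^ n * tail n \<le> tail 0"
proof -
  have "1 \<le> (\<Prod>k<n. 1 + (a k / tail (Suc k) - 1) / 2)"
    using ratio_gt_1 by (intro prod_ge_1) (simp add: less_imp_le)
  then have "2 ^ n * tail n * 1 \<le> tail 0"
    unfolding two_power_tail_eq[of n, symmetric]
    using tail_pos[of n] by (intro mult_left_mono) auto
  then show ?thesis by simp
qed

text \<open>By 1 + x \<le> exp x, summability bounds the product in
  \<open>two_power_tail_eq\<close>, so the total length stays away from 0.\<close>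

lemma two_power_tail_bounded_below:
  assumes "summable (\<lambda>k. a k / tail (Suc k) - 1)"
  obtains c where "0 < c" "\<And>n. c \<le> 2 ^ n * tail n"
proof
  let ?x = "\<lambda>k. (a k / tail (Suc k) - 1) / 2"
  let ?E = "exp (\<Sum>k. ?x k)"
  have x: "0 \<le> ?x k" for k using ratio_gt_1[of k] by simp
  show "0 < tail 0 / ?E" using tail_pos by simp
  fix n
  have "(\<Prod>k<n. 1 + ?x k) \<le> (\<Prod>k<n. exp (?x k))"
    using x by (intro prod_mono) (auto intro: exp_ge_add_one_self add_nonneg_nonneg)
  also have "\<dots> = exp (\<Sum>k<n. ?x k)" by (simp add: exp_sum)
  also have "\<dots> \<le> ?E"
    using assms x by (simp, intro sum_le_suminf summable_divide) auto
  finally have "tail 0 \<le> 2 ^ n * tail n * ?E"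
    unfolding two_power_tail_eq[of n, symmetric]
    using tail_pos[of n] by (intro mult_left_mono) auto
  then show "tail 0 / ?E \<le> 2 ^ n * tail n" by (simp add: field_simps)
qed

text \<open>The product in \<open>two_power_tail_eq\<close> dominates the partial sums and diverges
  with them.\<close>

lemma two_power_tail_tendsto_0:
  assumes "\<not> summable (\<lambda>k. a k / tail (Suc k) - 1)"
  shows "(\<lambda>n. 2 ^ n * tail n) \<longlonglongrightarrow> 0"
proof -
  let ?x = "\<lambda>k. (a k / tail (Suc k) - 1) / 2"
  let ?P = "\<lambda>n. \<Prod>k<n. 1 + ?x k"
  have x: "0 \<le> ?x k" for k using ratio_gt_1[of k] by simp
  have le: "(\<Sum>k<n. ?x k) \<le> ?P n" for n
    using x by (intro sum_le_prod_one_plus)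
  have "\<not> summable ?x"
    using assms summable_mult[of ?x 2] by auto
  have "filterlim (\<lambda>n. \<Sum>k<n. ?x k) at_top sequentially"
    using x \<open>\<not> summable ?x\<close> by (rule filterlim_partial_sums_at_top)
  then have "filterlim ?P at_top sequentially"
    by (rule filterlim_at_top_mono) (rule always_eventually, rule allI, rule le)
  then have "(\<lambda>n. tail 0 / ?P n) \<longlonglongrightarrow> 0"
    by (rule tendsto_divide_0[OF tendsto_const filterlim_at_top_imp_at_infinity])
  moreover have "tail 0 / ?P n = 2 ^ n * tail n" for n
  proof -
    have "0 < ?P n" using x by (intro prod_pos) (simp add: add_pos_nonneg)
    then have "2 ^ n * tail n * ?P n / ?P n = 2 ^ n * tail n"
      by (intro nonzero_mult_div_cancel_right less_imp_neq[THEN not_sym])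
    then show ?thesis
      by (simp only: two_power_tail_eq)
  qed
  ultimately show ?thesis by simp
qed

end

section \<open>Laws with product weights on the cylinders\<close>

locale superdecreasing_law = superdecreasing_series a + prob_space \<mu>
  for a :: "nat \<Rightarrow> real" and \<mu> :: "real measure" +
  fixes p0 p1 :: "nat \<Rightarrow> real"
  assumes sets_eq [simp]: "sets \<mu> = sets borel"
    and p0_nonneg: "\<And>k. 0 \<le> p0 k" and p1_nonneg: "\<And>k. 0 \<le> p1 k"
    and p_sum: "\<And>k. p0 k + p1 k = 1"
    and prob_cyl: "\<And>n S. S \<subseteq> {..<n} \<Longrightarrow> prob (cyl n S) = (\<Prod>k\<in>S. p1 k) * (\<Prod>k\<in>{..<n} - S. p0 k)"
begin

definition weight :: "nat \<Rightarrow> nat set \<Rightarrow> real" where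
  "weight n S = (\<Prod>k\<in>S. p1 k) * (\<Prod>k\<in>{..<n} - S. p0 k)"

lemma space_eq [simp]: "space \<mu> = UNIV"
  using sets_eq_imp_space_eq[OF sets_eq] by simp

lemma weight_nonneg: "0 \<le> weight n S"
  unfolding weight_def using p0_nonneg p1_nonneg by (intro mult_nonneg_nonneg prod_nonneg) auto

lemma sum_weight: "(\<Sum>S\<in>Pow {..<n}. weight n S) = 1"
  \<comment> \<open>Expanding the product of the factors p1 + p0 = 1 gives one term for each
    word.\<close>
  unfolding weight_def using prod_add[of "{..<n}" p1 p0] p_sum by (simp add: add.commute)

lemma prob_cyls:
  assumes "A \<subseteq> Pow {..<n}"
  shows "prob (cyls n A) = (\<Sum>S\<in>A. weight n S)"
proof -
  have "prob (cyls n A) = (\<Sum>S\<in>A. prob (cyl n S))"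
    unfolding cyls_def using assms
    by (intro finite_measure_finite_Union disjoint_family_cyl finite_words) auto
  also have "\<dots> = (\<Sum>S\<in>A. weight n S)"
    using assms by (intro sum.cong) (auto simp: weight_def prob_cyl)
  finally show ?thesis .
qed

lemma prob_compl_cyls:
  assumes "A \<subseteq> Pow {..<n}"
  shows "prob (- cyls n A) = (\<Sum>S\<in>Pow {..<n} - A. weight n S)"
proof -
  have "prob (- cyls n A) = 1 - prob (cyls n A)"
    using prob_compl[of "cyls n A"] cyls_borel[OF assms] by (simp add: Compl_eq_Diff_UNIV)
  also have "\<dots> = (\<Sum>S\<in>Pow {..<n}. weight n S) - (\<Sum>S\<in>A. weight n S)"
    by (simp add: sum_weight prob_cyls[OF assms])
  also have "\<dots> = (\<Sum>S\<in>Pow {..<n} - A. weight n S)"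
    using assms by (simp add: sum_diff)
  finally show ?thesis .
qed

section \<open>Atoms\<close>

lemma weight_le_prod_max:
  assumes "S \<subseteq> {..<n}"
  shows "weight n S \<le> (\<Prod>k<n. max (p0 k) (p1 k))"
proof -
  have "weight n S \<le> (\<Prod>k\<in>S. max (p0 k) (p1 k)) * (\<Prod>k\<in>{..<n} - S. max (p0 k) (p1 k))"
    unfolding weight_def using p0_nonneg p1_nonneg
    by (intro mult_mono prod_mono prod_nonneg) (auto intro: order_trans[OF p0_nonneg max.cobounded1])
  also have "\<dots> = (\<Prod>k<n. max (p0 k) (p1 k))"
    using assms by (metis finite_lessThan mult.commute prod.subset_diff)
  finally show ?thesis .
qed

lemma prob_singleton_le: "prob {x} \<le> (\<Prod>k<n. max (p0 k) (p1 k))"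
proof (cases "x \<in> cyls n (Pow {..<n})")
  case True
  then obtain S where S: "S \<subseteq> {..<n}" "x \<in> cyl n S" by (auto simp: cyls_def)
  then have "prob {x} \<le> prob (cyl n S)" by (intro finite_measure_mono) auto
  also have "\<dots> = weight n S" using S by (simp add: prob_cyl weight_def)
  also have "\<dots> \<le> (\<Prod>k<n. max (p0 k) (p1 k))" using S by (intro weight_le_prod_max)
  finally show ?thesis .
next
  case False
  \<comment> \<open>The weights sum to 1, so no mass is left outside the intervals of level
    n.\<close>
  then have "prob {x} \<le> prob (- cyls n (Pow {..<n}))"
    using cyls_borel[of "Pow {..<n}" n] by (intro finite_measure_mono) auto
  also have "\<dots> = 0" by (simp add: prob_compl_cyls)
  also have "0 \<le> (\<Prod>k<n. max (p0 k) (p1 k))"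
    using p0_nonneg by (intro prod_nonneg) (auto simp: le_max_iff_disj)
  finally show ?thesis .
qed

lemma prod_max_nonneg: "0 \<le> (\<Prod>k<n. max (p0 k) (p1 k))"
  using p0_nonneg by (intro prod_nonneg) (auto simp: le_max_iff_disj)

lemma decseq_prod_max: "decseq (\<lambda>n. \<Prod>k<n. max (p0 k) (p1 k))"
proof (rule decseq_SucI)
  fix n
  have "max (p0 n) (p1 n) \<le> 1"
    using p0_nonneg[of n] p1_nonneg[of n] p_sum[of n] by auto
  from mult_left_mono[OF this prod_max_nonneg[of n]]
  show "(\<Prod>k<Suc n. max (p0 k) (p1 k)) \<le> (\<Prod>k<n. max (p0 k) (p1 k))" by simp
qed

text \<open>The partial products decrease, so a limit always exists, and failure of the positivity
  criterion forces it to be 0.\<close>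

lemma prod_max_converges:
  obtains L where "0 \<le> L" "(\<lambda>n. \<Prod>k<n. max (p0 k) (p1 k)) \<longlonglongrightarrow> L"
proof -
  obtain L where L: "(\<lambda>n. \<Prod>k<n. max (p0 k) (p1 k)) \<longlonglongrightarrow> L"
    using decseq_convergent[OF decseq_prod_max, of 0] prod_max_nonneg by blast
  moreover have "0 \<le> L"
    using LIMSEQ_le_const[OF L] prod_max_nonneg by blast
  ultimately show ?thesis using that by blast
qed

lemma no_atoms:
  assumes "\<not> (\<exists>P>0. (\<lambda>n. \<Prod>k<n. max (p0 k) (p1 k)) \<longlonglongrightarrow> P)"
  shows "emeasure \<mu> {x} = 0"
proof -
  obtain L where L: "0 \<le> L" "(\<lambda>n. \<Prod>k<n. max (p0 k) (p1 k)) \<longlonglongrightarrow> L"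
    by (rule prod_max_converges)
  have "\<not> 0 < L" using assms L(2) by blast
  with L(1) have "L = 0" by linarith
  have "prob {x} \<le> 0"
    using LIMSEQ_le_const[OF L(2)] prob_singleton_le unfolding \<open>L = 0\<close> by blast
  then show ?thesis
    by (simp add: emeasure_eq_measure measure_le_0_iff)
qed

section \<open>Laws carried by Lebesgue null sets\<close>

lemma null_support_of_sparse:
  assumes "\<not> summable (\<lambda>k. a k / tail (Suc k) - 1)"
  shows "\<exists>N\<in>null_sets lborel. emeasure \<mu> (- N) = 0"
proof (rule ex_null_set_of_full_measure)
  show "finite_measure \<mu>" by unfold_locales
  show "cyls n (Pow {..<n}) \<in> sets borel" for n by (rule cyls_borel) simp
  show "emeasure lborel (cyls n (Pow {..<n})) \<le> ennreal (2 ^ n * tail n)" for n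
    by (simp add: emeasure_lborel_cyls card_Pow)
  \<comment> \<open>The same bound must serve length and missed mass; here the missed mass is
    0.\<close>
  show "prob (- cyls n (Pow {..<n})) \<le> 2 ^ n * tail n" for n
    using tail_pos[of n] by (simp add: prob_compl_cyls less_imp_le)
  show "(\<lambda>n. 2 ^ n * tail n) \<longlonglongrightarrow> 0" by (rule two_power_tail_tendsto_0) fact
qed simp

text \<open>Hellinger affinity between the law of the first n digits and the uniform law on words of
  length n.\<close>

definition affinity :: "nat \<Rightarrow> real" where
  "affinity n = (\<Prod>k<n. sqrt (p1 k / 2) + sqrt (p0 k / 2))"

text \<open>Spreading 2^n as one factor 2 per position keeps a product over digits, so the sum over
  words factorizes by \<open>prod_add\<close>.\<close>

lemma sqrt_weight:
  assumes "S \<subseteq> {..<n}"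
  shows "sqrt (weight n S / 2 ^ n) = (\<Prod>k\<in>S. sqrt (p1 k / 2)) * (\<Prod>k\<in>{..<n} - S. sqrt (p0 k / 2))"
proof -
  have fin: "finite S" using assms finite_subset by blast
  have "card S + card ({..<n} - S) = n"
    using assms fin by (simp add: card_Diff_subset) (metis card_lessThan card_mono finite_lessThan le_add_diff_inverse)
  then have "(2::real) ^ n = 2 ^ card S * 2 ^ card ({..<n} - S)"
    by (metis power_add)
  then have "weight n S / 2 ^ n = (\<Prod>k\<in>S. p1 k / 2) * (\<Prod>k\<in>{..<n} - S. p0 k / 2)"
    by (simp add: weight_def prod_dividef)
  moreover have "sqrt (\<Prod>k\<in>T. f k) = (\<Prod>k\<in>T. sqrt (f k))" for T :: "nat set" and f
    by (induction T rule: infinite_finite_induct) (auto simp: real_sqrt_mult)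
  ultimately show ?thesis by (simp add: real_sqrt_mult)
qed

lemma sum_sqrt_weight: "(\<Sum>S\<in>Pow {..<n}. sqrt (weight n S / 2 ^ n)) = affinity n"
proof -
  have "affinity n = (\<Sum>S\<in>Pow {..<n}. (\<Prod>k\<in>S. sqrt (p1 k / 2)) * (\<Prod>k\<in>{..<n} - S. sqrt (p0 k / 2)))"
    unfolding affinity_def by (rule prod_add) simp
  also have "\<dots> = (\<Sum>S\<in>Pow {..<n}. sqrt (weight n S / 2 ^ n))"
    by (rule sum.cong[OF refl]) (simp only: Pow_iff sqrt_weight)
  finally show ?thesis ..
qed

text \<open>With bias e, the squared factor is 1/2 + sqrt (1/4 - e^2) \<le> 1 - e^2 \<le> exp (-
  e^2).\<close>

lemma affinity_factor_le: "(sqrt (p1 k / 2) + sqrt (p0 k / 2))\<^sup>2 \<le> exp (- (1 / 2 - p0 k)\<^sup>2)"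
proof -
  define e where "e = 1 / 2 - p0 k"
  have p: "p0 k = 1 / 2 - e" "p1 k = 1 / 2 + e"
    using p_sum[of k] by (auto simp: e_def)
  have "\<bar>e\<bar> \<le> 1 / 2"
    using p0_nonneg[of k] p1_nonneg[of k] unfolding p by auto
  then have "e\<^sup>2 \<le> 1 / 4"
    using power_mono[of "\<bar>e\<bar>" "1/2" 2] by (simp add: power2_eq_square)
  have "p0 k * p1 k = 1 / 4 - e\<^sup>2"
    unfolding p by (simp add: algebra_simps power2_eq_square)
  \<comment> \<open>Completing the square adds only e^4.\<close>
  also have "\<dots> \<le> (1 / 2 - e\<^sup>2)\<^sup>2"
  proof -
    have "(1 / 2 - e\<^sup>2)\<^sup>2 = 1 / 4 - e\<^sup>2 + (e\<^sup>2)\<^sup>2"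
      by (simp add: power2_eq_square algebra_simps)
    then show ?thesis by simp
  qed
  finally have "sqrt (p0 k * p1 k) \<le> 1 / 2 - e\<^sup>2"
    using \<open>e\<^sup>2 \<le> 1 / 4\<close> by (intro real_le_lsqrt) auto
  moreover have "(sqrt (p1 k / 2) + sqrt (p0 k / 2))\<^sup>2 = 1 / 2 + sqrt (p0 k * p1 k)"
  proof -
    have "2 * (sqrt (p1 k / 2) * sqrt (p0 k / 2)) = sqrt (p0 k * p1 k)"
      using real_sqrt_mult[of 4 "p1 k / 2 * (p0 k / 2)"] by (simp add: real_sqrt_mult[symmetric] mult.commute)
    moreover have "(sqrt (p1 k / 2))\<^sup>2 = p1 k / 2" "(sqrt (p0 k / 2))\<^sup>2 = p0 k / 2"
      using p0_nonneg[of k] p1_nonneg[of k] by auto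
    ultimately show ?thesis
      using p_sum[of k] unfolding power2_sum by simp
  qed
  moreover have "1 + (- e\<^sup>2) \<le> exp (- e\<^sup>2)"
    by (rule exp_ge_add_one_self)
  ultimately show ?thesis unfolding e_def by linarith
qed

lemma affinity_nonneg: "0 \<le> affinity n"
  unfolding affinity_def using p0_nonneg p1_nonneg by (intro prod_nonneg) simp

lemma affinity_tendsto_0:
  assumes "\<not> summable (\<lambda>k. (1 / 2 - p0 k)\<^sup>2)"
  shows "affinity \<longlonglongrightarrow> 0"
proof -
  have le: "(affinity n)\<^sup>2 \<le> exp (- (\<Sum>k<n. (1 / 2 - p0 k)\<^sup>2))" for n
  proof -
    have "(affinity n)\<^sup>2 \<le> (\<Prod>k<n. exp (- (1 / 2 - p0 k)\<^sup>2))"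
      unfolding affinity_def prod_power_distrib
      using affinity_factor_le by (intro prod_mono) auto
    then show ?thesis by (simp add: exp_sum sum_negf[symmetric])
  qed
  have "filterlim (\<lambda>n. \<Sum>k<n. (1 / 2 - p0 k)\<^sup>2) at_top sequentially"
    using assms by (intro filterlim_partial_sums_at_top) auto
  then have lim: "(\<lambda>n. exp (- (\<Sum>k<n. (1 / 2 - p0 k)\<^sup>2))) \<longlonglongrightarrow> 0"
    by (intro filterlim_compose[OF exp_at_bot] filterlim_compose[OF filterlim_uminus_at_bot_at_top])
  have "(\<lambda>n. (affinity n)\<^sup>2) \<longlonglongrightarrow> 0"
  proof (rule tendsto_sandwich[OF _ _ tendsto_const lim])
    show "eventually (\<lambda>n. (affinity n)\<^sup>2 \<le> exp (- (\<Sum>k<n. (1 / 2 - p0 k)\<^sup>2))) sequentially"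
      by (rule always_eventually) (rule allI, rule le)
  qed simp
  then have "(\<lambda>n. sqrt ((affinity n)\<^sup>2)) \<longlonglongrightarrow> sqrt 0"
    by (rule tendsto_real_sqrt)
  then show ?thesis using affinity_nonneg by simp
qed

text \<open>The geometric mean of \<open>weight n S\<close> and the uniform weight 2^-n dominates
  the smaller of the two. Hence the uniform mass of the words above the threshold 2^-n and the given
  mass of the others are both at most the affinity.\<close>

lemma null_support_of_biased:
  assumes "\<not> summable (\<lambda>k. (1 / 2 - p0 k)\<^sup>2)"
  shows "\<exists>N\<in>null_sets lborel. emeasure \<mu> (- N) = 0"
proof (rule ex_null_set_of_full_measure)
  \<comment> \<open>words that are more likely under the given law than under the uniform one\<close>
  define A where "A n = {S \<in> Pow {..<n}. 1 / 2 ^ n < weight n S}" for n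
  have A: "A n \<subseteq> Pow {..<n}" for n by (auto simp: A_def)
  have sqrt_nonneg: "0 \<le> sqrt (weight n S / 2 ^ n)" for n S
    using weight_nonneg by simp
  show "finite_measure \<mu>" by unfold_locales
  show "cyls n (A n) \<in> sets borel" for n by (rule cyls_borel[OF A])
  \<comment> \<open>The affinity bounds the missed mass, \<open>tail 0\<close> times the affinity
    bounds the length; the maximum covers both.\<close>
  define e where "e n = max 1 (tail 0) * affinity n" for n
  have affinity_le: "affinity n \<le> e n" for n
    unfolding e_def using mult_right_mono[of 1 "max 1 (tail 0)" "affinity n"] affinity_nonneg[of n]
    by simp
  show "emeasure lborel (cyls n (A n)) \<le> ennreal (e n)" for n
  proof -
    have "card (A n) / 2 ^ n = (\<Sum>S\<in>A n. 1 / 2 ^ n)" by simp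
    also have "\<dots> \<le> (\<Sum>S\<in>A n. sqrt (weight n S / 2 ^ n))"
    proof (rule sum_mono)
      fix S assume "S \<in> A n"
      then have "1 / 2 ^ n \<le> weight n S" by (simp add: A_def less_imp_le)
      then have "1 / 2 ^ n / 2 ^ n \<le> weight n S / 2 ^ n"
        by (rule divide_right_mono) simp
      then have "(1 / 2 ^ n)\<^sup>2 \<le> weight n S / 2 ^ n"
        by (simp add: power2_eq_square)
      then show "1 / 2 ^ n \<le> sqrt (weight n S / 2 ^ n)"
        by (rule real_le_rsqrt)
    qed
    also have "\<dots> \<le> affinity n"
      unfolding sum_sqrt_weight[symmetric] using A sqrt_nonneg by (intro sum_mono2) auto
    finally have "card (A n) / 2 ^ n * (2 ^ n * tail n) \<le> affinity n * tail 0"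
      using two_power_tail_le[of n] tail_pos[of n] affinity_nonneg[of n]
      by (intro mult_mono) auto
    also have "\<dots> \<le> e n"
      unfolding e_def using affinity_nonneg[of n]
      by (subst mult.commute) (intro mult_right_mono, auto)
    finally have "card (A n) * tail n \<le> e n" by simp
    then show ?thesis
      unfolding emeasure_lborel_cyls[OF A] by (rule ennreal_leI)
  qed
  show "prob (- cyls n (A n)) \<le> e n" for n
  proof -
    have "prob (- cyls n (A n)) = (\<Sum>S\<in>Pow {..<n} - A n. weight n S)"
      by (rule prob_compl_cyls[OF A])
    also have "\<dots> \<le> (\<Sum>S\<in>Pow {..<n} - A n. sqrt (weight n S / 2 ^ n))"
    proof (rule sum_mono)
      fix S assume "S \<in> Pow {..<n} - A n"
      then have "weight n S \<le> 1 / 2 ^ n" by (auto simp: A_def)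
      then have "(weight n S)\<^sup>2 \<le> weight n S / 2 ^ n"
        using mult_left_mono[OF _ weight_nonneg, of "weight n S" "1 / 2 ^ n" n S]
        by (simp add: power2_eq_square)
      then show "weight n S \<le> sqrt (weight n S / 2 ^ n)"
        by (rule real_le_rsqrt)
    qed
    also have "\<dots> \<le> affinity n"
      unfolding sum_sqrt_weight[symmetric] using sqrt_nonneg by (intro sum_mono2) auto
    finally show ?thesis using affinity_le[of n] by linarith
  qed
  show "e \<longlonglongrightarrow> 0"
    unfolding e_def using tendsto_mult_right_zero[OF affinity_tendsto_0[OF assms]] by simp
qed simp

section \<open>Absolute continuity\<close>

text \<open>The exponential bounds the second moment, under the uniform law on words of length n, of the
  likelihood ratio of the law of the first n digits.\<close>

lemma cyls_second_moment:
  assumes sq: "summable (\<lambda>k. (1 / 2 - p0 k)\<^sup>2)" and A: "A \<subseteq> Pow {..<n}"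
  shows "(prob (cyls n A))\<^sup>2 \<le> card A / 2 ^ n * exp (4 * (\<Sum>k. (1 / 2 - p0 k)\<^sup>2))"
proof -
  have "(prob (cyls n A))\<^sup>2 = (\<Sum>S\<in>A. 1 * weight n S)\<^sup>2"
    by (simp add: prob_cyls[OF A])
  also have "\<dots> \<le> (\<Sum>S\<in>A. 1\<^sup>2) * (\<Sum>S\<in>A. (weight n S)\<^sup>2)"
    by (rule Cauchy_Schwarz_ineq_sum)
  also have "\<dots> \<le> card A * (\<Sum>S\<in>Pow {..<n}. (weight n S)\<^sup>2)"
    using A by (simp add: mult_left_mono sum_mono2)
  \<comment> \<open>Squared weights are again products over digits, so their sum factorizes;
    splitting 1/2 off each factor then isolates the deviation from the uniform law.\<close>
  also have "(\<Sum>S\<in>Pow {..<n}. (weight n S)\<^sup>2) = (\<Prod>k<n. (p1 k)\<^sup>2 + (p0 k)\<^sup>2)"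
    by (simp add: prod_add weight_def power_mult_distrib prod_power_distrib)
  also have "\<dots> = (\<Prod>k<n. (1 + 4 * (1 / 2 - p0 k)\<^sup>2) / 2)"
  proof (rule prod.cong)
    fix k
    have "p1 k = 1 - p0 k" using p_sum[of k] by simp
    then show "(p1 k)\<^sup>2 + (p0 k)\<^sup>2 = (1 + 4 * (1 / 2 - p0 k)\<^sup>2) / 2"
      unfolding \<open>p1 k = 1 - p0 k\<close> by (simp add: power2_eq_square field_simps)
  qed simp
  also have "\<dots> = (\<Prod>k<n. 1 + 4 * (1 / 2 - p0 k)\<^sup>2) / 2 ^ n"
    by (simp add: prod_dividef)
  also have "(\<Prod>k<n. 1 + 4 * (1 / 2 - p0 k)\<^sup>2) \<le> (\<Prod>k<n. exp (4 * (1 / 2 - p0 k)\<^sup>2))"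
    by (intro prod_mono) (auto intro: add_nonneg_nonneg exp_ge_add_one_self)
  also have "\<dots> = exp (4 * (\<Sum>k<n. (1 / 2 - p0 k)\<^sup>2))"
    by (simp add: exp_sum sum_distrib_left)
  also have "\<dots> \<le> exp (4 * (\<Sum>k. (1 / 2 - p0 k)\<^sup>2))"
    using sq by (simp add: sum_le_suminf)
  finally show ?thesis by (simp add: mult_left_mono divide_right_mono)
qed

text \<open>The interval of level n around x has length \<open>tail n\<close>, so it eventually fits
  into any ball around x.\<close>

lemma eventually_mem_cyls_of_open:
  assumes U: "open U" and x: "x \<in> U" "\<And>n. x \<in> cyls n (Pow {..<n})"
  shows "eventually (\<lambda>n. x \<in> cyls n {S \<in> Pow {..<n}. cyl n S \<subseteq> U}) sequentially"
proof -
  obtain e where e: "0 < e" "ball x e \<subseteq> U" using U x(1) by (rule openE)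
  have "eventually (\<lambda>n. tail n < e) sequentially"
    using tail_tendsto_0 e(1) by (rule order_tendstoD)
  then show ?thesis
  proof eventually_elim
    case (elim n)
    obtain S where S: "S \<subseteq> {..<n}" "x \<in> cyl n S" using x(2)[of n] by (auto simp: cyls_def)
    have "cyl n S \<subseteq> ball x e"
      using S(2) elim by (auto simp: cyl_def dist_real_def)
    then show ?case using S e(2) by (auto simp: cyls_def)
  qed
qed

text \<open>Up to a \<mu>-null set, \<open>U\<close> is exhausted by intervals contained in it;
  \<open>c\<close> converts their total length into a share of words, to which
  \<open>cyls_second_moment\<close> applies.\<close>

lemma prob_open_le:
  assumes sq: "summable (\<lambda>k. (1 / 2 - p0 k)\<^sup>2)"
    and c: "0 < c" "\<And>n. c \<le> 2 ^ n * tail n"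
    and U: "open U" "emeasure lborel U \<le> ennreal h" "0 \<le> h"
  shows "(prob U)\<^sup>2 \<le> h / c * exp (4 * (\<Sum>k. (1 / 2 - p0 k)\<^sup>2))" (is "_ \<le> h / c * ?K")
proof -
  define A where "A n = {S \<in> Pow {..<n}. cyl n S \<subseteq> U}" for n
  have A: "A n \<subseteq> Pow {..<n}" for n by (auto simp: A_def)
  note borel_A [measurable] = cyls_borel[OF A]
  \<comment> \<open>The unions at successive levels need not be nested, since splitting an interval
    leaves a gap. Intersections over all later levels do increase, which permits continuity from
    below.\<close>
  define D where "D m = (\<Inter>n\<in>{m..}. cyls n (A n))" for m
  have D_borel: "D m \<in> sets borel" for m
    unfolding D_def by (intro sets.countable_INT'') auto
  have AE: "AE x in \<mu>. \<forall>n. x \<in> cyls n (Pow {..<n})"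
  proof (subst AE_all_countable, intro allI)
    fix n
    have "prob (- cyls n (Pow {..<n})) = 0" by (simp add: prob_compl_cyls)
    then show "AE x in \<mu>. x \<in> cyls n (Pow {..<n})"
      using cyls_borel[of "Pow {..<n}" n] 
      by (subst AE_iff_measurable[where N="- cyls n (Pow {..<n})"]) (auto simp: emeasure_eq_measure)
  qed
  have "(prob (D m))\<^sup>2 \<le> h / c * ?K" for m
  proof -
    have "cyls m (A m) \<subseteq> U" by (auto simp: cyls_def A_def)
    then have "emeasure lborel (cyls m (A m)) \<le> emeasure lborel U"
      using U(1) by (intro emeasure_mono) auto
    then have "ennreal (card (A m) * tail m) \<le> ennreal h"
      using U(2) unfolding emeasure_lborel_cyls[OF A] by (rule order_trans)
    then have card: "card (A m) * tail m \<le> h"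
      using \<open>0 \<le> h\<close> by (simp add: ennreal_le_iff)
    \<comment> \<open>All intervals of level m together have length at least \<open>c\<close>, so a
      length bound limits the share of words.\<close>
    have "card (A m) / 2 ^ m * c \<le> card (A m) / 2 ^ m * (2 ^ m * tail m)"
      using c(2) by (intro mult_left_mono) auto
    also have "\<dots> \<le> h" using card by simp
    finally have "card (A m) / 2 ^ m \<le> h / c" using c(1) by (simp add: pos_le_divide_eq)
    then have "card (A m) / 2 ^ m * ?K \<le> h / c * ?K" by (intro mult_right_mono) auto
    moreover have "(prob (D m))\<^sup>2 \<le> (prob (cyls m (A m)))\<^sup>2"
      unfolding D_def by (intro power_mono finite_measure_mono) auto
    ultimately show ?thesis using cyls_second_moment[OF sq A, of m] by linarith
  qed
  moreover have "(\<lambda>m. (prob (D m))\<^sup>2) \<longlonglongrightarrow> (prob (\<Union>m. D m))\<^sup>2"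
    using D_borel by (intro tendsto_power finite_Lim_measure_incseq) (auto simp: incseq_def D_def)
  ultimately have union: "(prob (\<Union>m. D m))\<^sup>2 \<le> h / c * ?K"
    by (blast intro: LIMSEQ_le_const2)
  have "AE x in \<mu>. x \<in> U \<longrightarrow> x \<in> (\<Union>m. D m)"
    using AE
  proof (rule AE_mp, intro AE_I2 impI)
    fix x assume "\<forall>n. x \<in> cyls n (Pow {..<n})" "x \<in> U"
    then have "eventually (\<lambda>n. x \<in> cyls n (A n)) sequentially"
      unfolding A_def using U(1) by (intro eventually_mem_cyls_of_open) auto
    then show "x \<in> (\<Union>m. D m)" by (auto simp: eventually_sequentially D_def)
  qed
  then have "prob U \<le> prob (\<Union>m. D m)"
    using D_borel by (intro finite_measure_mono_AE) auto
  then have "(prob U)\<^sup>2 \<le> (prob (\<Union>m. D m))\<^sup>2" by (intro power_mono) auto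
  with union show ?thesis by linarith
qed

text \<open>By outer regularity a Lebesgue null set lies in open sets of arbitrarily small measure,
  and \<open>prob_open_le\<close> controls these.\<close>

lemma absolutely_continuous_lborel:
  assumes "summable (\<lambda>k. a k / tail (Suc k) - 1)" and sq: "summable (\<lambda>k. (1 / 2 - p0 k)\<^sup>2)"
  shows "absolutely_continuous lborel \<mu>"
  unfolding absolutely_continuous_def
proof
  fix E :: "real set" assume E: "E \<in> null_sets lborel"
  obtain c where c: "0 < c" "\<And>n. c \<le> 2 ^ n * tail n"
    using two_power_tail_bounded_below[OF assms(1)] by blast
  let ?K = "exp (4 * (\<Sum>k. (1 / 2 - p0 k)\<^sup>2))"
  have E_borel: "E \<in> sets borel" using E by auto
  have le: "(prob E)\<^sup>2 \<le> h / c * ?K" if h: "0 < h" for h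
  proof -
    obtain U where U: "open U" "E \<subseteq> U" "emeasure lborel (U - E) < ennreal h"
      using outer_regular_lborel[OF E_borel h] by blast
    have "emeasure lborel U = emeasure lborel (U - E)"
      using E U(1) by (intro emeasure_Diff_null_set[symmetric]) auto
    then have "(prob U)\<^sup>2 \<le> h / c * ?K"
      using U h by (intro prob_open_le[OF sq c]) auto
    moreover have "(prob E)\<^sup>2 \<le> (prob U)\<^sup>2"
      using U E_borel by (intro power_mono finite_measure_mono) auto
    ultimately show ?thesis by linarith
  qed
  have "(prob E)\<^sup>2 \<le> 0"
  proof (rule field_le_epsilon)
    fix e :: real assume "0 < e"
    \<comment> \<open>This choice of h turns the bound into exactly e.\<close>
    then show "(prob E)\<^sup>2 \<le> 0 + e" using le[of "e * c / ?K"] c by simp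
  qed
  then show "E \<in> null_sets \<mu>"
    using E_borel by (auto intro!: null_setsI simp: emeasure_eq_measure)
qed

end

section \<open>The random series and its law\<close>

locale superdecreasing_expansion = superdecreasing_series a + prob_space M
  for a :: "nat \<Rightarrow> real" and M :: "'a measure" +
  fixes p0 p1 :: "nat \<Rightarrow> real" and \<phi> :: "nat \<Rightarrow> 'a \<Rightarrow> real"
  assumes indep: "indep_vars (\<lambda>_. borel) \<phi> UNIV"
    and prob_0: "\<And>k. prob {\<omega> \<in> space M. \<phi> k \<omega> = 0} = p0 k"
    and prob_1: "\<And>k. prob {\<omega> \<in> space M. \<phi> k \<omega> = 1} = p1 k"
    and p_sum: "\<And>k. p0 k + p1 k = 1"
begin

definition X :: "'a \<Rightarrow> real" where
  "X \<omega> = (\<Sum>k. \<phi> k \<omega> * a k)"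

lemma measurable_digit [measurable]: "\<phi> k \<in> borel_measurable M"
  using indep by (auto simp: indep_vars_def)

lemma measurable_X [measurable]: "X \<in> borel_measurable M"
  unfolding X_def by measurable

lemma p_nonneg: "0 \<le> p0 k" "0 \<le> p1 k"
  using prob_0[of k] prob_1[of k] measure_nonneg by metis+

text \<open>Only the masses at 0 and 1 are given; they add up to 1, so other values have probability
  0.\<close>

lemma AE_digits: "AE \<omega> in M. \<forall>k. \<phi> k \<omega> \<in> {0, 1}"
proof (subst AE_all_countable, intro allI)
  fix k
  have "prob ({\<omega> \<in> space M. \<phi> k \<omega> = 0} \<union> {\<omega> \<in> space M. \<phi> k \<omega> = 1}) = 1"
    by (subst finite_measure_Union) (auto simp: prob_0 prob_1 p_sum)
  then have "AE \<omega> in M. \<omega> \<in> {\<omega> \<in> space M. \<phi> k \<omega> = 0} \<union> {\<omega> \<in> space M. \<phi> k \<omega> = 1}"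
    by (subst prob_eq_1[symmetric]) auto
  then show "AE \<omega> in M. \<phi> k \<omega> \<in> {0, 1}" by eventually_elim auto
qed

lemma prob_word:
  assumes S: "S \<subseteq> {..<n}"
  shows "prob {\<omega> \<in> space M. \<forall>k<n. \<phi> k \<omega> = (if k \<in> S then 1 else 0)}
    = (\<Prod>k\<in>S. p1 k) * (\<Prod>k\<in>{..<n} - S. p0 k)"
\<comment> \<open>An intersection over no index would be \<open>UNIV\<close> instead of
  \<open>space M\<close>, so the empty word is treated apart.\<close>
proof (cases "n = 0")
  case True
  then show ?thesis using S by (simp add: prob_space)
next
  case False
  have "{\<omega> \<in> space M. \<forall>k<n. \<phi> k \<omega> = (if k \<in> S then 1 else 0)}
      = (\<Inter>k\<in>{..<n}. \<phi> k -` {if k \<in> S then 1 else 0} \<inter> space M)"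
    using False by auto
  also have "prob \<dots> = (\<Prod>k\<in>{..<n}. prob (\<phi> k -` {if k \<in> S then 1 else 0} \<inter> space M))"
    using False by (intro indep_varsD[OF indep]) auto
  also have "\<dots> = (\<Prod>k\<in>{..<n}. if k \<in> S then p1 k else p0 k)"
    by (intro prod.cong refl) (auto simp: prob_0[symmetric] prob_1[symmetric] intro!: arg_cong[where f=prob])
  also have "\<dots> = (\<Prod>k\<in>S. p1 k) * (\<Prod>k\<in>{..<n} - S. p0 k)"
    using S by (simp add: prod.If_cases Int_absorb1 Diff_eq)
  finally show ?thesis .
qed

lemma measure_distr_cyl:
  assumes S: "S \<subseteq> {..<n}"
  shows "measure (distr M borel X) (cyl n S) = (\<Prod>k\<in>S. p1 k) * (\<Prod>k\<in>{..<n} - S. p0 k)"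
proof -
  have "measure (distr M borel X) (cyl n S) = prob (X -` cyl n S \<inter> space M)"
    by (simp add: measure_distr)
  also have "\<dots> = prob {\<omega> \<in> space M. \<forall>k<n. \<phi> k \<omega> = (if k \<in> S then 1 else 0)}"
  \<comment> \<open>Digits may leave {0, 1} on a null set, where the interval need not determine
    them.\<close>
  proof (rule finite_measure_eq_AE)
    show "AE \<omega> in M. \<omega> \<in> X -` cyl n S \<inter> space M \<longleftrightarrow>
        \<omega> \<in> {\<omega> \<in> space M. \<forall>k<n. \<phi> k \<omega> = (if k \<in> S then 1 else 0)}"
      using AE_digits
    proof eventually_elim
      case (elim \<omega>)
      then show ?case
        using expansion_mem_cyl_iff[of "\<lambda>k. \<phi> k \<omega>" S n] S by (auto simp: X_def)
    qed
  qed auto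
  also have "\<dots> = (\<Prod>k\<in>S. p1 k) * (\<Prod>k\<in>{..<n} - S. p0 k)"
    by (rule prob_word[OF S])
  finally show ?thesis .
qed

sublocale law: superdecreasing_law a "distr M borel X" p0 p1
proof -
  interpret D: prob_space "distr M borel X" by (rule prob_space_distr) simp
  show "superdecreasing_law a (distr M borel X) p0 p1"
    by unfold_locales (auto simp: p_nonneg p_sum measure_distr_cyl)
qed

section \<open>The discrete case\<close>

lemma AE_eventually_likely_digit:
  assumes P: "0 < P" "(\<lambda>n. \<Prod>k<n. max (p0 k) (p1 k)) \<longlonglongrightarrow> P"
  shows "AE \<omega> in M. eventually (\<lambda>k. \<phi> k \<omega> = (if p0 k \<le> p1 k then 1 else 0)) sequentially"
proof -
  let ?m = "\<lambda>k. max (p0 k) (p1 k)"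
  let ?B = "\<lambda>k. {\<omega> \<in> space M. \<phi> k \<omega> \<noteq> (if p0 k \<le> p1 k then 1 else 0)}"
  have m: "0 < ?m k" "?m k \<le> 1" for k
    using p_nonneg[of k] p_sum[of k] by auto
  have "prob (?B k) = 1 - ?m k" for k
  proof -
    have "prob (?B k) = prob (space M - {\<omega> \<in> space M. \<phi> k \<omega> = (if p0 k \<le> p1 k then 1 else 0)})"
      by (rule arg_cong[where f=prob]) auto
    also have "\<dots> = 1 - prob {\<omega> \<in> space M. \<phi> k \<omega> = (if p0 k \<le> p1 k then 1 else 0)}"
      by (rule prob_compl) measurable
    also have "\<dots> = 1 - ?m k" by (simp add: prob_0 prob_1 max_def)
    finally show ?thesis .
  qed
  \<comment> \<open>The decreasing products stay above \<open>P\<close>; taking logarithms, ln x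
    \<le> x - 1 bounds the summed probabilities of the less likely digits.\<close>
  moreover have "summable (\<lambda>k. 1 - ?m k)"
  proof (rule summableI_nonneg_bounded)
    fix n
    have "P \<le> (\<Prod>k<n. ?m k)" using law.decseq_prod_max P(2) by (rule decseq_ge)
    then have "ln P \<le> ln (\<Prod>k<n. ?m k)" using P(1) by (subst ln_le_cancel_iff) auto
    also have "\<dots> = (\<Sum>k<n. ln (?m k))"
      using m(1) by (intro ln_prod less_imp_neq[THEN not_sym]) auto
    also have "\<dots> \<le> (\<Sum>k<n. ?m k - 1)" using m(1) by (intro sum_mono ln_le_minus_one)
    finally show "(\<Sum>k<n. 1 - ?m k) \<le> - ln P" by (simp add: sum_subtractf)
  qed (use m(2) in simp)
  ultimately have "AE \<omega> in M. eventually (\<lambda>k. \<omega> \<in> space M - ?B k) sequentially"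
    by (intro borel_cantelli_AE1) (auto simp: less_top[symmetric])
  then show ?thesis
    by eventually_elim (auto elim: eventually_mono)
qed

lemma discrete_law:
  assumes P: "0 < P" "(\<lambda>n. \<Prod>k<n. max (p0 k) (p1 k)) \<longlonglongrightarrow> P"
  shows "purely_discrete (distr M borel X)"
proof -
  define c :: "nat \<Rightarrow> real" where "c k = (if p0 k \<le> p1 k then 1 else 0)" for k
  \<comment> \<open>\<open>G F\<close> is the value of the series when exactly the digits indexed by
    \<open>F\<close> differ from the likelier ones \<open>c\<close>; there are only countably many
    finite \<open>F\<close>.\<close>
  define G where "G F = (\<Sum>k. (if k \<in> F then 1 - c k else c k) * a k)" for F
  define C where "C = G ` Collect finite"
  have C: "countable C" unfolding C_def by (intro countable_image countable_Collect_finite)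
  have "AE \<omega> in M. X \<omega> \<in> C"
    using AE_digits AE_eventually_likely_digit[OF P]
  proof eventually_elim
    case (elim \<omega>)
    let ?F = "{k. \<phi> k \<omega> \<noteq> c k}"
    have digit: "\<phi> k \<omega> = (if k \<in> ?F then 1 - c k else c k)" for k
      using elim(1) by (auto simp: c_def dest!: spec[of _ k])
    have "X \<omega> = G ?F"
      unfolding X_def G_def by (intro suminf_cong arg_cong2[where f="(*)"] digit refl)
    moreover have "finite ?F"
      using elim(2) unfolding c_def[symmetric] cofinite_eq_sequentially[symmetric] eventually_cofinite .
    ultimately show ?case unfolding C_def by blast
  qed
  moreover have C_borel: "C \<in> sets borel" by (rule sets.countable[OF _ C]) simp
  ultimately have "AE x in distr M borel X. x \<in> C"
    by (subst AE_distr_iff) auto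
  then have "emeasure (distr M borel X) (- C) = 0"
    using C_borel by (subst (asm) AE_iff_measurable[where N="- C"]) auto
  then show ?thesis using C unfolding purely_discrete_def by blast
qed

section \<open>Mutual exclusion of the types\<close>

lemma trichotomy:
  defines "D \<equiv> \<exists>P>0. (\<lambda>n. \<Prod>k<n. max (p0 k) (p1 k)) \<longlonglongrightarrow> P"
    and "S \<equiv> summable (\<lambda>k. a k / tail (Suc k) - 1) \<and> summable (\<lambda>k. (1 / 2 - p0 k)\<^sup>2)"
    and "\<mu> \<equiv> distr M borel X"
  shows "pure_type \<mu> \<and> (purely_discrete \<mu> \<longleftrightarrow> D) \<and> (purely_abs_continuous \<mu> \<longleftrightarrow> S)
    \<and> (purely_singular \<mu> \<longleftrightarrow> \<not> D \<and> \<not> S)"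
proof -
  have discrete: "D \<Longrightarrow> purely_discrete \<mu>"
    unfolding D_def \<mu>_def using discrete_law by blast
  have no_atoms: "\<not> D \<Longrightarrow> emeasure \<mu> {x} = 0" for x
    unfolding D_def \<mu>_def by (rule law.no_atoms)
  have ac: "S \<Longrightarrow> purely_abs_continuous \<mu>"
    unfolding S_def \<mu>_def purely_abs_continuous_def by (blast intro: law.absolutely_continuous_lborel)
  have null: "\<not> S \<Longrightarrow> \<exists>N\<in>null_sets lborel. emeasure \<mu> (- N) = 0"
    unfolding S_def \<mu>_def using law.null_support_of_sparse law.null_support_of_biased by blast
  \<comment> \<open>A law of total mass 1 cannot vanish on both a set and its complement.\<close>
  have total: "emeasure \<mu> N \<noteq> 0" if "emeasure \<mu> (- N) = 0" "N \<in> sets borel" for N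
  proof
    assume "emeasure \<mu> N = 0"
    with that have "emeasure \<mu> (N \<union> - N) = 0"
      unfolding \<mu>_def by (subst emeasure_Un_null_set) (auto simp: null_sets_def)
    then show False using law.emeasure_space_1 by (simp add: \<mu>_def)
  qed
  have discrete_atom: "\<exists>x. emeasure \<mu> {x} \<noteq> 0" if discr: "purely_discrete \<mu>"
  proof (rule ccontr)
    assume no: "\<not> ?thesis"
    obtain C where C: "countable C" "emeasure \<mu> (- C) = 0"
      using discr unfolding purely_discrete_def by blast
    have "emeasure \<mu> C = (\<integral>\<^sup>+x. emeasure \<mu> {x} \<partial>count_space C)"
      using C(1) by (intro emeasure_countable_singleton) (auto simp: \<mu>_def)
    then have "emeasure \<mu> C = 0" using no by simp
    moreover have "C \<in> sets borel" by (rule sets.countable[OF _ C(1)]) simp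
    ultimately show False using total[OF C(2)] by blast
  qed
  have ac_no_null: "\<not> purely_abs_continuous \<mu>" if N: "N \<in> null_sets lborel" "emeasure \<mu> (- N) = 0" for N
  proof
    assume "purely_abs_continuous \<mu>"
    then have "N \<in> null_sets \<mu>"
      using N(1) unfolding purely_abs_continuous_def absolutely_continuous_def by blast
    moreover have "N \<in> sets borel" using N(1) by auto
    ultimately show False using total[OF N(2)] by (simp add: null_setsD1)
  qed
  have D_iff: "purely_discrete \<mu> \<longleftrightarrow> D"
    using discrete no_atoms discrete_atom by blast
  have S_iff: "purely_abs_continuous \<mu> \<longleftrightarrow> S"
    using ac null ac_no_null by blast
  \<comment> \<open>A singular law has no atoms, against \<open>D\<close> by
    \<open>discrete_atom\<close>, and a null support, against \<open>S\<close> by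
    \<open>ac_no_null\<close>.\<close>
  have sing_iff: "purely_singular \<mu> \<longleftrightarrow> \<not> D \<and> \<not> S"
    unfolding purely_singular_def using no_atoms null discrete discrete_atom ac ac_no_null by blast
  show ?thesis
    unfolding pure_type_def using D_iff S_iff sing_iff by blast
qed

end

text \<open>Indices start at 0, one below the usual numbering. Positivity of the infinite product
  reads as a positive limit of partial products, which always converge because the factors lie in
  [0, 1].\<close>

theorem theorem12:
  fixes M :: "'a measure"
    and a p0 p1 r \<delta> :: "nat \<Rightarrow> real"
    and \<phi> :: "nat \<Rightarrow> 'a \<Rightarrow> real"
    and \<mu> :: "real measure"
  assumes "\<And>k. a k > 0"
    and "a sums 1"
    and "\<And>k. p0 k \<ge> 0" and "\<And>k. p1 k \<ge> 0" and "\<And>k. p0 k + p1 k = 1"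
    and "prob_space M"
    and "prob_space.indep_vars M (\<lambda>_. borel) \<phi> UNIV"
    and "\<And>k. measure M {\<omega> \<in> space M. \<phi> k \<omega> = 0} = p0 k"
    and "\<And>k. measure M {\<omega> \<in> space M. \<phi> k \<omega> = 1} = p1 k"
    and "\<mu> = distr M borel (\<lambda>\<omega>. \<Sum>k. \<phi> k \<omega> * a k)"
    and "\<And>k. r k = (\<Sum>i. a (i + (k + 1)))"
    and "\<And>k. \<delta> k = a k / r k"
    and "\<And>k. \<delta> k > 1"
  shows "pure_type \<mu>
    \<and> (purely_discrete \<mu> \<longleftrightarrow> (\<exists>P > 0. (\<lambda>n. \<Prod>k<n. max (p0 k) (p1 k)) \<longlonglongrightarrow> P))
    \<and> (purely_abs_continuous \<mu> \<longleftrightarrow>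
         summable (\<lambda>k. \<delta> k - 1) \<and> summable (\<lambda>k. (1 / 2 - p0 k)\<^sup>2))
    \<and> (purely_singular \<mu> \<longleftrightarrow>
         \<not> (\<exists>P > 0. (\<lambda>n. \<Prod>k<n. max (p0 k) (p1 k)) \<longlonglongrightarrow> P)
         \<and> \<not> (summable (\<lambda>k. \<delta> k - 1) \<and> summable (\<lambda>k. (1 / 2 - p0 k)\<^sup>2)))"
proof -
  note a_pos = assms(1) and a_sums = assms(2) and p_sum = assms(5) and M = assms(6)
    and indep = assms(7) and prob_0 = assms(8) and prob_1 = assms(9) and \<mu> = assms(10)
    and r = assms(11) and \<delta> = assms(12) and \<delta>_gt_1 = assms(13)
  interpret prob_space M by (rule M)
  have summ: "summable a" using a_sums by (rule sums_summable)
  have r_less: "r k < a k" for k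
  proof -
    \<comment> \<open>Positivity of the remainder lets the condition \<delta> > 1 be cleared of its
      denominator.\<close>
    have "0 < r k"
      unfolding r using summ a_pos by (intro suminf_pos) (auto simp only: summable_iff_shift)
    then show ?thesis using \<delta>_gt_1[of k] unfolding \<delta> by simp
  qed
  interpret superdecreasing_expansion a M p0 p1 \<phi>
    by unfold_locales (use summ a_pos r_less p_sum indep prob_0 prob_1 in \<open>simp_all add: r\<close>)
  have \<delta>_eq: "\<delta> k = a k / tail (Suc k)" for k
    by (simp add: \<delta> r tail_def)
  have "\<mu> = distr M borel X"
    unfolding \<mu> X_def ..
  then show ?thesis
    using trichotomy unfolding \<delta>_eq by simp
qed

end
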